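(* Let $R$ be a ring, $a\in R$, and $n\geq 1$ an integer. If $a,a^2,\ldots,a^n$ are all regular elements of $R$, then there exists $w\in R$ such that $$a^iw^ja^j=w^{j-i}a^j\qquad\text{and}\qquad a^jw^ja^i=a^jw^{j-i}\qquad\text{for all }1\leq i\leq j\leq n.$$ In particular, $a^iw^ia^i=a^i$ for all $1\leq i\leq n$. Moreover, if $a$ is unit-regular in $R$, then one can take $w$ to be a unit of $R$.
   Context: Rings are associative with $1$, not necessarily commutative. An element $b\in R$ is (von Neumann) regular if there is $r\in R$ with $brb=b$, and unit-regular if there is a unit $u\in R$ with $bub=b$. Here $w^0=1$. *)

theory Defs
  imports Main
begin

text \<open>
  Rings are taken in the sort \<open>{ring, monoid_mult}\<close>: associative rings with \<open>1\<close>,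
  not necessarily commutative.  The class \<open>ring_1\<close> would in addition impose \<open>0 \<noteq> 1\<close>
  and so exclude the zero ring.
\<close>

definition regular_elem :: "'a::{ring, monoid_mult} \<Rightarrow> bool" where
  "regular_elem b \<longleftrightarrow> (\<exists>r. b * r * b = b)"

text \<open>
  Units are two-sided; the library's \<open>is_unit\<close> is divisibility of \<open>1\<close> and is
  only available for commutative multiplication.
\<close>

definition unit_elem :: "'a::{ring, monoid_mult} \<Rightarrow> bool" where
  "unit_elem u \<longleftrightarrow> (\<exists>v. u * v = 1 \<and> v * u = 1)"

definition unit_regular_elem :: "'a::{ring, monoid_mult} \<Rightarrow> bool" where
  "unit_regular_elem b \<longleftrightarrow> (\<exists>u. unit_elem u \<and> b * u * b = b)"

end

(* For an inner inverse w of a, put e = a w and g = w a.  If e preserves every ker (a^i) and g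
   every im (a^i), i < n, that is a^i e \<in> R a^i and g a^i \<in> a^i R, then w maps ker (a^i) into
   ker (a^(i+1)) and im (a^(i+1)) into im (a^i), and the required identities follow.  The idempotents
   e and g can be chosen independently: from any inner inverse u, the element w = g u e has
   a w = e and w a = g.  Adding u - u a u changes neither product, and makes w a unit when u is. *)

theory Submission
  imports Defs
begin

text \<open>From \<open>e * a = a\<close> and \<open>e = a * x\<close>, \<open>e\<close> is
  idempotent with eR = aR. The induction corrects \<open>e\<close> so that one more kernel becomes
  stable. Gaining exponent k costs the regularity of a^(k+1), hence the bound \<open>Suc m\<close>
  on the regular powers against \<open>m\<close> in the conclusion.\<close>

lemma ex_left_idempotent:
  fixes a :: "'a::{ring, monoid_mult}"
  assumes "\<forall>i. 1 \<le> i \<and> i \<le> Suc m \<longrightarrow> regular_elem (a ^ i)"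
  shows "\<exists>e. e * a = a \<and> (\<exists>x. e = a * x) \<and> (\<forall>i\<le>m. \<exists>r. a ^ i * e = r * a ^ i)"
  using assms
proof (induction m)
  case 0
  have "regular_elem (a ^ 1)" by (rule "0.prems"[rule_format]) simp
  then obtain r where "a * r * a = a" by (auto simp: regular_elem_def)
  then show ?case by (intro exI[of _ "a * r"]) auto
next
  case (Suc m)
  have "\<forall>i. 1 \<le> i \<and> i \<le> Suc m \<longrightarrow> regular_elem (a ^ i)" using Suc.prems by auto
  from Suc.IH[OF this]
  obtain e x where e: "e * a = a" "e = a * x" "\<forall>i\<le>m. \<exists>r. a ^ i * e = r * a ^ i"
    by blast
  let ?k = "Suc m"
  have "regular_elem (a ^ Suc ?k)" by (rule Suc.prems[rule_format]) simp
  then obtain r where r: "a ^ Suc ?k * r * a ^ Suc ?k = a ^ Suc ?k"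
    unfolding regular_elem_def by blast
  (* The correction vanishes on ker (a^i) for i < k, since there (1 - e) y lies in ker (a^k), and it
     cancels the part a^k e of a^k e', leaving a multiple of a^k. *)
  define e' where "e' = e + a * r * a ^ ?k * (1 - e)"
  have e'a: "e' * a = a"
    using e(1) by (simp add: e'_def algebra_simps)
  have e'x: "e' = a * (x + r * a ^ ?k * (1 - e))"
    by (subst e'_def, subst e(2)) (simp add: algebra_simps)
  have "\<exists>r. a ^ i * e' = r * a ^ i" if "i \<le> ?k" for i
  proof (cases "i = ?k")
    case True
    \<comment> \<open>As \<open>e\<close> lies in aR, this product lies in a^(k+1) R, where
      \<open>a ^ Suc ?k * r\<close> acts as the identity.\<close>
    have ke: "a ^ ?k * e = a ^ Suc ?k * x"
      by (subst e(2)) (simp only: power_Suc2 mult.assoc)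
    have "a ^ ?k * e' = a ^ ?k * e + a ^ Suc ?k * r * a ^ ?k - a ^ Suc ?k * r * (a ^ ?k * e)"
      by (simp only: e'_def power_Suc2[of a ?k] distrib_left right_diff_distrib mult_1_right mult.assoc
          add_diff_eq)
    also have "a ^ Suc ?k * r * (a ^ ?k * e) = a ^ ?k * e"
      unfolding ke mult.assoc[symmetric] r ..
    finally have "a ^ ?k * e' = (a ^ Suc ?k * r) * a ^ ?k" by simp
    then show ?thesis using True by blast
  next
    case False
    with that have "i \<le> m" by simp
    then obtain s where s: "a ^ i * e = s * a ^ i" using e(3) by blast
    \<comment> \<open>Splitting \<open>a ^ ?k\<close> as \<open>c * a ^ i\<close> makes the
      correction end in \<open>a ^ i - a ^ i * e = (1 - s) * a ^ i\<close>, so stability at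
      \<open>i\<close> survives.\<close>
    define c where "c = a ^ (?k - i)"
    have c: "a ^ ?k = c * a ^ i" 
      using that by (simp only: c_def power_add[symmetric] le_add_diff_inverse le_add_diff_inverse2)
    define d where "d = a ^ i * a * r * c"
    have "a ^ i * e' = a ^ i * e + d * (a ^ i - a ^ i * e)"
      by (simp only: e'_def d_def c distrib_left right_diff_distrib mult_1_right mult.assoc)
    then have "a ^ i * e' = (s + d * (1 - s)) * a ^ i"
      unfolding s by (simp add: algebra_simps)
    then show ?thesis by blast
  qed
  then have "e' * a = a \<and> (\<exists>x. e' = a * x) \<and> (\<forall>i\<le>?k. \<exists>r. a ^ i * e' = r * a ^ i)"
    using e'a e'x by blast
  then show ?case by (rule exI)
qed

text \<open>This is \<open>ex_left_idempotent\<close> in the opposite ring, with images of powers in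
  place of kernels.\<close>

lemma ex_right_idempotent:
  fixes a :: "'a::{ring, monoid_mult}"
  assumes "\<forall>i. 1 \<le> i \<and> i \<le> Suc m \<longrightarrow> regular_elem (a ^ i)"
  shows "\<exists>g. a * g = a \<and> (\<exists>y. g = y * a) \<and> (\<forall>i\<le>m. \<exists>r. g * a ^ i = a ^ i * r)"
  using assms
proof (induction m)
  case 0
  have "regular_elem (a ^ 1)" by (rule "0.prems"[rule_format]) simp
  then obtain r where "a * r * a = a" by (auto simp: regular_elem_def)
  then show ?case by (intro exI[of _ "r * a"]) (auto simp: mult.assoc)
next
  case (Suc m)
  have "\<forall>i. 1 \<le> i \<and> i \<le> Suc m \<longrightarrow> regular_elem (a ^ i)" using Suc.prems by auto
  from Suc.IH[OF this]
  obtain g y where g: "a * g = a" "g = y * a" "\<forall>i\<le>m. \<exists>r. g * a ^ i = a ^ i * r"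
    by blast
  let ?k = "Suc m"
  have "regular_elem (a ^ Suc ?k)" by (rule Suc.prems[rule_format]) simp
  then obtain r where r: "a ^ Suc ?k * r * a ^ Suc ?k = a ^ Suc ?k"
    unfolding regular_elem_def by blast
  \<comment> \<open>The correction is killed by \<open>a\<close> on the left, since
    \<open>a * (1 - g) = 0\<close>. On \<open>a ^ ?k\<close> its part with \<open>- g\<close>
    cancels \<open>g * a ^ ?k\<close>, because the latter equals \<open>y * a ^ Suc ?k\<close> and
    \<open>r\<close> is an inner inverse of \<open>a ^ Suc ?k\<close>; the rest lies in a^k
    R.\<close>
  define g' where "g' = g + (1 - g) * a ^ ?k * r * a"
  have ag': "a * g' = a"
    using g(1) by (simp add: g'_def ring_distribs flip: mult.assoc)
  have g'y: "g' = (y + (1 - g) * a ^ ?k * r) * a"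
    by (subst g'_def, subst g(2)) (simp add: algebra_simps)
  have "\<exists>r. g' * a ^ i = a ^ i * r" if "i \<le> ?k" for i
  proof (cases "i = ?k")
    case True
    have gk: "g * a ^ ?k = y * a ^ Suc ?k"
      by (subst g(2)) (simp only: power_Suc mult.assoc)
    have "g' * a ^ ?k = g * a ^ ?k + a ^ ?k * r * a ^ Suc ?k - g * a ^ ?k * (r * a ^ Suc ?k)"
      by (simp only: g'_def power_Suc[of a ?k] distrib_right left_diff_distrib mult_1_left mult.assoc
          add_diff_eq)
    also have "g * a ^ ?k * (r * a ^ Suc ?k) = g * a ^ ?k"
      unfolding gk using r by (simp only: mult.assoc)
    finally have "g' * a ^ ?k = a ^ ?k * (r * a ^ Suc ?k)" by (simp add: mult.assoc)
    then show ?thesis using True by blast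
  next
    case False
    with that have "i \<le> m" by simp
    then obtain s where s: "g * a ^ i = a ^ i * s" using g(3) by blast
    define c where "c = a ^ (?k - i)"
    have c: "a ^ ?k = a ^ i * c" 
      using that by (simp only: c_def power_add[symmetric] le_add_diff_inverse le_add_diff_inverse2)
    define d where "d = c * r * a * a ^ i"
    have "g' * a ^ i = g * a ^ i + (a ^ i - g * a ^ i) * d"
      by (simp only: g'_def d_def c distrib_right left_diff_distrib mult_1_left mult.assoc)
    then have "g' * a ^ i = a ^ i * (s + (1 - s) * d)"
      unfolding s by (simp add: algebra_simps)
    then show ?thesis by blast
  qed
  then have "a * g' = a \<and> (\<exists>y. g' = y * a) \<and> (\<forall>i\<le>?k. \<exists>r. g' * a ^ i = a ^ i * r)"
    using ag' g'y by blast
  then show ?case by (rule exI)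
qed

text \<open>By \<open>img\<close>, \<open>w\<close> maps a^(k+1) R into a^k R for k \<le> m. So
  \<open>w ^ p * a ^ Suc p\<close> still starts with a factor \<open>a\<close>, on which
  \<open>a * w\<close> acts as the identity, and the factors of \<open>a ^ i\<close> cancel one by
  one.\<close>

lemma left_identity:
  fixes a w :: "'a::{ring, monoid_mult}"
  assumes awa: "a * w * a = a"
    and img: "\<forall>k\<le>m. \<exists>r. w * a * a ^ k = a ^ k * r"
    and "i \<le> j" "j \<le> Suc m"
  shows "a ^ i * w ^ j * a ^ j = w ^ (j - i) * a ^ j"
proof -
  have descend: "\<exists>r. w ^ p * a ^ j = a ^ (j - p) * r" if "p < j" "j \<le> Suc m" for p j
    using that
  proof (induction p)
    case 0
    then show ?case by (auto intro: exI[of _ 1])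
  next
    case (Suc p)
    then obtain r where r: "w ^ p * a ^ j = a ^ (j - p) * r" by auto
    have "j - p = Suc (j - Suc p)" using Suc.prems by simp
    then have "w ^ Suc p * a ^ j = w * a * a ^ (j - Suc p) * r"
      using r by (simp add: mult.assoc)
    moreover have "j - Suc p \<le> m" using Suc.prems by simp
    then obtain s where "w * a * a ^ (j - Suc p) = a ^ (j - Suc p) * s"
      using img by blast
    ultimately show ?case by (metis mult.assoc)
  qed
  have step: "a * w ^ Suc p * a ^ Suc p = w ^ p * a ^ Suc p" if p: "p \<le> m" for p
  proof -
    obtain r where "w ^ p * a ^ Suc p = a * r" using descend[of p "Suc p"] p by auto
    then have "a * w ^ Suc p * a ^ Suc p = a * w * a * r"
      by (simp only: power_Suc[of w] mult.assoc)
    then show ?thesis using awa \<open>w ^ p * a ^ Suc p = a * r\<close> by simp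
  qed
  show ?thesis
    using assms(3,4)
  proof (induction i arbitrary: j)
    case 0
    then show ?case by simp
  next
    case (Suc i)
    then obtain p where j: "j = Suc p" "i \<le> p" "p \<le> m" by (cases j) auto
    \<comment> \<open>One \<open>a\<close> cancels against one \<open>w\<close>, and one
      \<open>a\<close> is split off on the right; what remains is the claim for \<open>i\<close> and
      j - 1, which is why \<open>j\<close> varies in the induction.\<close>
    have "a ^ Suc i * w ^ j * a ^ j = a ^ i * (a * w ^ Suc p * a ^ Suc p)"
      by (simp only: j(1) power_Suc2[of a i] mult.assoc)
    also have "\<dots> = (a ^ i * w ^ p * a ^ p) * a"
      using step[OF j(3)] by (simp only: power_Suc2 mult.assoc)
    also have "\<dots> = w ^ (j - Suc i) * a ^ j"
      using Suc.IH[of p] j by (simp only: power_Suc2 mult.assoc) simp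
    finally show ?case .
  qed
qed

text \<open>Mirror image of \<open>left_identity\<close>: by \<open>ker\<close>,
  \<open>a ^ Suc p * w ^ p\<close> still ends in a factor \<open>a\<close>, which absorbs
  \<open>w * a\<close> on its right.\<close>

lemma right_identity:
  fixes a w :: "'a::{ring, monoid_mult}"
  assumes awa: "a * w * a = a"
    and ker: "\<forall>k\<le>m. \<exists>r. a ^ k * (a * w) = r * a ^ k"
    and "i \<le> j" "j \<le> Suc m"
  shows "a ^ j * w ^ j * a ^ i = a ^ j * w ^ (j - i)"
proof -
  have descend: "\<exists>r. a ^ j * w ^ p = r * a ^ (j - p)" if "p < j" "j \<le> Suc m" for p j
    using that
  proof (induction p)
    case 0
    then show ?case by (auto intro: exI[of _ 1])
  next
    case (Suc p)
    then obtain r where r: "a ^ j * w ^ p = r * a ^ (j - p)" by auto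
    have "j - p = Suc (j - Suc p)" using Suc.prems by simp
    then have "a ^ j * w ^ Suc p = r * (a ^ (j - Suc p) * (a * w))"
      using r by (simp only: power_Suc2 flip: mult.assoc)
    moreover have "j - Suc p \<le> m" using Suc.prems by simp
    then obtain s where "a ^ (j - Suc p) * (a * w) = s * a ^ (j - Suc p)"
      using ker by blast
    ultimately show ?case by (metis mult.assoc)
  qed
  have step: "a ^ Suc p * w ^ Suc p * a = a ^ Suc p * w ^ p" if p: "p \<le> m" for p
  proof -
    obtain r where "a ^ Suc p * w ^ p = r * a" using descend[of p "Suc p"] p by auto
    then have "a ^ Suc p * w ^ Suc p * a = r * (a * w * a)"
      by (simp only: power_Suc2[of w] flip: mult.assoc)
    then show ?thesis using awa \<open>a ^ Suc p * w ^ p = r * a\<close> by simp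
  qed
  show ?thesis
    using assms(3,4)
  proof (induction i arbitrary: j)
    case 0
    then show ?case by simp
  next
    case (Suc i)
    then obtain p where j: "j = Suc p" "i \<le> p" "p \<le> m" by (cases j) auto
    have "a ^ j * w ^ j * a ^ Suc i = (a ^ Suc p * w ^ Suc p * a) * a ^ i"
      by (simp only: j(1) power_Suc[of a i] mult.assoc)
    also have "\<dots> = a * (a ^ p * w ^ p * a ^ i)"
      using step[OF j(3)] by (simp only: power_Suc mult.assoc)
    also have "\<dots> = a ^ j * w ^ (j - Suc i)"
      using Suc.IH[of p] j by (simp add: mult.assoc)
    finally show ?case .
  qed
qed

text \<open>The element is glued from two isomorphisms: \<open>g * u * e\<close> from eR onto gR,
  inverse to \<open>a\<close>, and \<open>u - u * a * u\<close> from (1-e)R onto (1-g)R, the kernel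
  of \<open>a\<close>.\<close>

lemma unit_elem_modified_inverse:
  fixes a e g u :: "'a::{ring, monoid_mult}"
  assumes e: "e * a = a" "e = a * x" and g: "a * g = a" "g = y * a"
    and u: "unit_elem u" "a * u * a = a"
  shows "unit_elem (g * u * e + (u - u * a * u))"
proof -
  obtain v where v: "u * v = 1" "v * u = 1" using u(1) by (auto simp: unit_elem_def)
  have aue: "a * u * e = e" using e(2) u(2) by (metis mult.assoc)
  have gua: "g * u * a = g" using g(2) u(2) by (metis mult.assoc)
  have ee: "e * e = e" using e by (metis mult.assoc)
  have gg: "g * g = g" using g by (metis mult.assoc)
  define h where "h = u - u * a * u"
  \<comment> \<open>The inverse is glued likewise: \<open>a\<close> takes gR back to eR, and
    \<open>v\<close>, cut down by the complementary idempotents, takes (1-g)R back to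
    (1-e)R.\<close>
  define z where "z = a + (1 - e) * v * (1 - g)"
  have ha: "h * a = 0" and he: "h * e = 0"
    using u(2) aue by (simp_all add: h_def ring_distribs mult.assoc)
  have ah: "a * h = 0" and gh: "g * h = 0"
    using u(2) gua by (simp_all add: h_def ring_distribs flip: mult.assoc)
  have hv: "h * v = 1 - u * a"
    using v by (simp add: h_def ring_distribs mult.assoc)
  have vh: "v * h = 1 - a * u"
    using v by (simp add: h_def ring_distribs flip: mult.assoc)
  \<comment> \<open>The grouping isolates the cross term \<open>e - e * e\<close>, which vanishes,
    and \<open>h - h * e\<close>, which is \<open>h\<close>.\<close>
  have "(g * u * e + h) * z = g * u * (e * a) + h * a
      + (g * u * (e - e * e) + (h - h * e)) * v * (1 - g)"
    by (simp add: z_def algebra_simps)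
  also have "\<dots> = g + h * v * (1 - g)"
    using e(1) ha ee he gua by simp
  also have "\<dots> = 1"
    using g(1) by (simp add: hv algebra_simps)
  finally have 1: "(g * u * e + h) * z = 1" .
  have "z * (g * u * e + h) = a * g * u * e + a * h
      + (1 - e) * v * ((g - g * g) * u * e + (h - g * h))"
    by (simp add: z_def algebra_simps)
  also have "\<dots> = e + (1 - e) * (v * h)"
    using g(1) aue ah gg gh by (simp add: mult.assoc)
  also have "\<dots> = 1"
    using e(1) by (simp add: vh ring_distribs flip: mult.assoc)
  finally have "z * (g * u * e + h) = 1" .
  with 1 show ?thesis unfolding unit_elem_def h_def by blast
qed

theorem theorem4p1:
  fixes a :: "'a::{ring, monoid_mult}" and n :: nat
  assumes "n \<ge> 1"
    and "\<forall>i. 1 \<le> i \<and> i \<le> n \<longrightarrow> regular_elem (a ^ i)"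
  shows "(\<exists>w.
            (\<forall>i j. 1 \<le> i \<and> i \<le> j \<and> j \<le> n \<longrightarrow>
                a ^ i * w ^ j * a ^ j = w ^ (j - i) * a ^ j \<and>
                a ^ j * w ^ j * a ^ i = a ^ j * w ^ (j - i)) \<and>
            (\<forall>i. 1 \<le> i \<and> i \<le> n \<longrightarrow> a ^ i * w ^ i * a ^ i = a ^ i)) \<and>
         (unit_regular_elem a \<longrightarrow>
          (\<exists>w. unit_elem w \<and>
            (\<forall>i j. 1 \<le> i \<and> i \<le> j \<and> j \<le> n \<longrightarrow>
                a ^ i * w ^ j * a ^ j = w ^ (j - i) * a ^ j \<and>
                a ^ j * w ^ j * a ^ i = a ^ j * w ^ (j - i)) \<and>
            (\<forall>i. 1 \<le> i \<and> i \<le> n \<longrightarrow> a ^ i * w ^ i * a ^ i = a ^ i)))"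
    (is "(\<exists>w. ?P w) \<and> (_ \<longrightarrow> (\<exists>w. _ w \<and> ?P w))")
proof -
  \<comment> \<open>Stability up to m = n - 1 suffices for exponents up to n, since it is always
    applied after one factor \<open>a\<close> has been split off.\<close>
  obtain m where n: "n = Suc m" using assms(1) by (cases n) auto
  obtain e x where e: "e * a = a" "e = a * x" "\<forall>i\<le>m. \<exists>r. a ^ i * e = r * a ^ i"
    using ex_left_idempotent assms(2) n by metis
  obtain g y where g: "a * g = a" "g = y * a" "\<forall>i\<le>m. \<exists>r. g * a ^ i = a ^ i * r"
    using ex_right_idempotent assms(2) n by metis
  \<comment> \<open>\<open>u\<close> is left arbitrary to serve both claims with the same
    \<open>e\<close> and \<open>g\<close>: any inner inverse gives existence, a unit one gives a
    unit.\<close>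
  have P: "?P (g * u * e + (u - u * a * u))" if u: "a * u * a = a" for u
  proof -
    define w where "w = g * u * e + (u - u * a * u)"
    have aue: "a * u * e = e" using e(2) u by (metis mult.assoc)
    have gua: "g * u * a = g" using g(2) u by (metis mult.assoc)
    have aw: "a * w = e"
      using g(1) aue u by (simp add: w_def ring_distribs flip: mult.assoc)
    have wa: "w * a = g"
      using e(1) gua u by (simp add: w_def ring_distribs mult.assoc)
    have awa: "a * w * a = a" using aw e(1) by simp
    have L: "a ^ i * w ^ j * a ^ j = w ^ (j - i) * a ^ j" if "i \<le> j" "j \<le> n" for i j
      using left_identity[OF awa, of m i j] g(3) that unfolding wa n by blast
    have R: "a ^ j * w ^ j * a ^ i = a ^ j * w ^ (j - i)" if "i \<le> j" "j \<le> n" for i j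
      using right_identity[OF awa, of m i j] e(3) that unfolding aw n by blast
    show ?thesis unfolding w_def[symmetric] using L R by simp
  qed
  have "regular_elem (a ^ 1)" using assms by blast
  then obtain u where "a * u * a = a" by (auto simp: regular_elem_def)
  then have "\<exists>w. ?P w" using P by blast
  moreover have "\<exists>w. unit_elem w \<and> ?P w" if "unit_regular_elem a"
    using that P unit_elem_modified_inverse[OF e(1,2) g(1,2)]
    unfolding unit_regular_elem_def by blast
  ultimately show ?thesis by blast
qed

end
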